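(* Let $n<N$ be positive integers, let $A$ be a real $n\times N$ matrix, and let $H^N=[0,1]^N$ be the $N$-dimensional hypercube. Then $$f_k(AH^N)<f_k(H^N),\qquad k=0,1,2,\ldots,n .$$
   Context: For a polytope $Q$, $f_k(Q)$ denotes the number of $k$-dimensional faces of $Q$ (with $Q$ itself counted as a face of dimension $\dim Q$); $AQ$ is the image of $Q$ under $A$. *)

theory Defs
  imports "HOL-Analysis.Analysis"
begin

text \<open>Faces are those of the library's \<^const>\<open>face_of\<close>, so a nonempty polytope is a face
  of itself.  The empty face has affine dimension -1 and is never counted, as k is natural.\<close>

definition num_faces :: "nat \<Rightarrow> 'a::euclidean_space set \<Rightarrow> nat" where
  "num_faces k Q = card {F. F face_of Q \<and> aff_dim F = int k}"

definition hypercube :: "(real ^ 'N) set" where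
  "hypercube = {x. \<forall>i. 0 \<le> x $ i \<and> x $ i \<le> 1}"

end

theory Submission
  imports Defs
begin

text \<open>A $k$-face $F$ of $AH$ pulls back to a face of $H$, and this face contains a $k$-face $G$
  of $H$ whose image is still $k$-dimensional, because the images of its edge directions contain a
  basis. Such a $G$ determines $F$, so choosing one $G$ for each $F$ is injective.
  It is not onto: let $v \<noteq> 0$ be in the kernel of $A$. If at most $k$ coordinates of $v$ are
  nonzero, a $k$-face containing the direction $v$ is degenerate under $A$. Otherwise, take a
  $k$-face $G$ with edge directions in the support of $v$, placed such that moving into the
  direction $v$ stays inside $H$. If $G$ is chosen for $F$, then the pullback of $F$ also contains
  a translate of $G$, which can be chosen for no face.\<close>

section \<open>Faces of the cube, described by free and fixed coordinates\<close>

definition cube_face :: "'N set \<Rightarrow> real ^ 'N \<Rightarrow> (real ^ 'N) set" where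
  "cube_face T x = {y \<in> hypercube. \<forall>i. i \<notin> T \<longrightarrow> y $ i = x $ i}"

lemma hypercube_eq_cbox: "(hypercube :: (real ^ 'N) set) = cbox 0 1"
  by (auto simp: hypercube_def mem_box_cart)

lemma polytope_hypercube: "polytope (hypercube :: (real ^ 'N) set)"
  by (simp add: hypercube_eq_cbox polytope_interval)

text \<open>At a fixed coordinate the value is an extreme point of [0,1]: a convex combination with
  positive weights reaches 0 or 1 only if both of its terms do. The values of \<open>x\<close> on
  the free set \<open>T\<close> do not matter.\<close>

lemma cube_face_of_hypercube:
  assumes "\<And>i. i \<notin> T \<Longrightarrow> x $ i = 0 \<or> x $ i = 1"
  shows "cube_face T x face_of (hypercube :: (real ^ 'N) set)"
proof -
  have conv: "convex (hypercube :: (real ^ 'N) set)"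
    using polytope_hypercube polytope_imp_convex by blast
  have eq: "cube_face T x = hypercube \<inter> (\<Inter>i\<in>-T. {y. y $ i = x $ i})"
    by (auto simp: cube_face_def)
  have "convex {y :: real ^ 'N. y $ i = x $ i}" for i
    using convex_hyperplane[of "axis i 1 :: real ^ 'N" "x $ i"]
    by (simp add: inner_axis inner_commute)
  then have convF: "convex (cube_face T x)"
    unfolding eq by (intro convex_Int conv convex_INT)
  have "a \<in> cube_face T x \<and> b \<in> cube_face T x"
    if a: "a \<in> hypercube" and b: "b \<in> hypercube" and y: "y \<in> cube_face T x"
      and seg: "y \<in> open_segment a b" for a b y
  proof -
    obtain u where u: "0 < u" "u < 1" "y = (1 - u) *\<^sub>R a + u *\<^sub>R b"
      using seg by (auto simp: in_segment)
    have "a $ i = x $ i \<and> b $ i = x $ i" if i: "i \<notin> T" for i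
    proof -
      have e: "(1 - u) * a $ i + u * b $ i = x $ i"
        using y i u by (auto simp: cube_face_def)
      have bds: "0 \<le> a $ i" "a $ i \<le> 1" "0 \<le> b $ i" "b $ i \<le> 1"
        using a b by (auto simp: hypercube_def)
      consider "x $ i = 0" | "x $ i = 1" using assms[OF i] by blast
      then show ?thesis
      proof cases
        case 1
        have "(1 - u) * a $ i \<ge> 0" "u * b $ i \<ge> 0" using bds u by auto
        then have "(1 - u) * a $ i = 0" "u * b $ i = 0" using e 1 by linarith+
        then show ?thesis using u 1 by auto
      next
        case 2
        have "(1 - u) * (1 - a $ i) \<ge> 0" "u * (1 - b $ i) \<ge> 0" using bds u by auto
        moreover have "(1 - u) * (1 - a $ i) + u * (1 - b $ i) = 0"
          using e 2 by (simp add: algebra_simps)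
        ultimately have "(1 - u) * (1 - a $ i) = 0" "u * (1 - b $ i) = 0" by linarith+
        then show ?thesis using u 2 by auto
      qed
    qed
    then show ?thesis using a b by (auto simp: cube_face_def)
  qed
  moreover have "cube_face T x \<subseteq> hypercube" by (auto simp: cube_face_def)
  ultimately show ?thesis
    unfolding face_of_def using convF by blast
qed

text \<open>Take \<open>x\<close> in the relative interior of \<open>P\<close> and let
  \<open>T\<close> be its coordinates strictly between 0 and 1. The face
  \<open>cube_face T x\<close> meets the relative interior of \<open>P\<close>, so it contains
  \<open>P\<close>. Conversely, any other point \<open>y\<close> of it is an endpoint of a segment
  in the cube passing through \<open>x\<close> in its interior, and the face property of
  \<open>P\<close> forces \<open>y\<close> into \<open>P\<close>.\<close>

lemma face_of_hypercube_cases: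
  assumes P: "P face_of (hypercube :: (real ^ 'N) set)" and ne: "P \<noteq> {}"
  obtains T x where "x \<in> hypercube" "\<And>i. i \<notin> T \<Longrightarrow> x $ i = 0 \<or> x $ i = 1" "P = cube_face T x"
proof -
  have "rel_interior P \<noteq> {}"
    using P ne face_of_imp_convex rel_interior_eq_empty by blast
  then obtain x where x: "x \<in> rel_interior P" by blast
  then have xP: "x \<in> P" using rel_interior_subset by blast
  then have xH: "x \<in> hypercube" using P face_of_imp_subset by blast
  define T where "T = {i. 0 < x $ i \<and> x $ i < 1}"
  have T: "x $ i = 0 \<or> x $ i = 1" if "i \<notin> T" for i
  proof -
    have "0 \<le> x $ i" "x $ i \<le> 1" using xH by (auto simp: hypercube_def)
    then show ?thesis using that unfolding T_def mem_Collect_eq by linarith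
  qed
  have 1: "P \<subseteq> cube_face T x"
    by (rule subset_of_face_of[OF cube_face_of_hypercube[OF T]])
       (use P face_of_imp_subset x xH in \<open>auto simp: cube_face_def\<close>)
  have 2: "y \<in> P" if y: "y \<in> cube_face T x" for y
  proof (cases "y = x")
    case False
    have yH: "y \<in> hypercube" using y by (auto simp: cube_face_def)
    \<comment> \<open>A step length that keeps the free coordinates of \<open>x\<close> inside
      [0,1], since no coordinate of \<open>x - y\<close> exceeds 1 in absolute value. Inserting 1
      keeps the minimum defined when \<open>T\<close> is empty.\<close>
    define e where "e = Min (insert 1 ((\<lambda>i. min (x $ i) (1 - x $ i)) ` T))"
    have e0: "e > 0" unfolding e_def by (auto simp: T_def)
    have eT: "e \<le> x $ i" "e \<le> 1 - x $ i" if "i \<in> T" for i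
    proof -
      have "e \<le> min (x $ i) (1 - x $ i)" unfolding e_def using that by (intro Min_le) auto
      then show "e \<le> x $ i" "e \<le> 1 - x $ i" by auto
    qed
    define z where "z = x + e *\<^sub>R (x - y)"
    have "0 \<le> z $ i \<and> z $ i \<le> 1" for i
    proof (cases "i \<in> T")
      case True
      have "\<bar>x $ i - y $ i\<bar> \<le> 1"
        using xH yH unfolding hypercube_def by (smt (verit) mem_Collect_eq)
      then have "\<bar>e * (x $ i - y $ i)\<bar> \<le> e"
        using e0 by (simp add: abs_mult)
      then show ?thesis using eT[OF True] by (simp add: z_def abs_le_iff)
    next
      case False
      then show ?thesis using y xH by (auto simp: z_def cube_face_def hypercube_def)
    qed
    then have zH: "z \<in> hypercube" by (simp add: hypercube_def)
    \<comment> \<open>This solves the definition of \<open>z\<close> for \<open>x\<close>.\<close>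
    have "x = (1 - 1 / (1 + e)) *\<^sub>R y + (1 / (1 + e)) *\<^sub>R z"
    proof -
      have "(1 / (1 + e)) * e = 1 - 1 / (1 + e)" using e0 by (simp add: field_simps)
      then have "(1 / (1 + e)) *\<^sub>R z = (1 / (1 + e)) *\<^sub>R x + (1 - 1 / (1 + e)) *\<^sub>R (x - y)"
        by (simp only: z_def scaleR_add_right scaleR_scaleR)
      then show ?thesis by (simp add: scaleR_left_diff_distrib scaleR_right_diff_distrib)
    qed
    moreover have "y \<noteq> z"
    proof
      assume "y = z"
      then have "(1 + e) *\<^sub>R (x - y) = 0" by (simp add: z_def algebra_simps)
      then show False using e0 False by auto
    qed
    ultimately have "x \<in> open_segment y z"
      unfolding in_segment using e0 by (intro conjI exI[of _ "1 / (1 + e)"]) auto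
    then show ?thesis using P yH zH xP unfolding face_of_def by blast
  qed (use xP in simp)
  show thesis using that[of x T] xH T 1 2 by blast
qed

section \<open>Dimensions of cube faces and of their linear images\<close>

lemma in_span_axis:
  assumes "\<And>i. i \<notin> T \<Longrightarrow> y $ i = 0"
  shows "(y :: real ^ 'N) \<in> span ((\<lambda>i. axis i 1) ` T)"
proof -
  have "y = (\<Sum>i\<in>UNIV. y $ i *\<^sub>R axis i 1)"
    by (metis (no_types, lifting) basis_expansion scalar_mult_eq_scaleR sum.cong)
  also have "\<dots> = (\<Sum>i\<in>T. y $ i *\<^sub>R axis i 1)"
    using assms by (intro sum.mono_neutral_right) auto
  also have "\<dots> \<in> span ((\<lambda>i. axis i 1) ` T)"
    by (intro span_sum span_scale span_base) auto
  finally show ?thesis .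
qed

lemma span_cube_face_origin:
  "span (cube_face T (0 :: real ^ 'N)) = span ((\<lambda>i. axis i 1) ` T)"
proof (rule subset_antisym; rule span_minimal[OF _ subspace_span])
  show "cube_face T 0 \<subseteq> span ((\<lambda>i. axis i (1::real)) ` T)"
    by (auto intro!: in_span_axis simp: cube_face_def)
  show "(\<lambda>i. axis i 1) ` T \<subseteq> span (cube_face T (0 :: real ^ 'N))"
    by (auto intro!: span_base simp: cube_face_def hypercube_def axis_def)
qed

text \<open>Translating by \<open>w\<close> moves the face to the origin, where affine dimension is
  linear dimension and the face spans the same space as its edge directions. Any base point in the
  cube is allowed, as only the translation depends on it.\<close>

lemma aff_dim_linear_image_cube_face:
  fixes f :: "real ^ 'N \<Rightarrow> 'b :: euclidean_space"
  assumes f: "linear f" and x: "x \<in> hypercube"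
  shows "aff_dim (f ` cube_face T x) = int (dim (f ` (\<lambda>i. axis i 1) ` T))"
proof -
  define w where "w = (\<chi> i. if i \<in> T then 0 else x $ i)"
  have "cube_face T x = (+) w ` cube_face T 0"
  proof (intro set_eqI iffI)
    fix y assume "y \<in> cube_face T x"
    then have "y - w \<in> cube_face T 0"
      by (auto simp: cube_face_def hypercube_def w_def)
    then show "y \<in> (+) w ` cube_face T 0" by (metis add_diff_cancel_left' diff_add_cancel
      add.commute image_eqI)
  next
    fix y assume "y \<in> (+) w ` cube_face T 0"
    then show "y \<in> cube_face T x"
      using x by (auto simp: cube_face_def hypercube_def w_def)
  qed
  then have "f ` cube_face T x = (+) (f w) ` f ` cube_face T 0"
    by (simp add: image_image linear_add[OF f])
  then have "aff_dim (f ` cube_face T x) = aff_dim (f ` cube_face T 0)"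
    by (simp add: aff_dim_translation_eq)
  also have "\<dots> = int (dim (f ` cube_face T 0))"
  proof (rule aff_dim_zero, rule hull_inc)
    have "(0 :: real ^ 'N) \<in> cube_face T 0" by (simp add: cube_face_def hypercube_def)
    then show "0 \<in> f ` cube_face T 0" using linear_0[OF f] by (metis image_eqI)
  qed
  also have "dim (f ` cube_face T 0) = dim (f ` (\<lambda>i. axis i 1) ` T)"
    by (intro span_eq_dim)
       (simp add: linear_span_image[OF f] span_cube_face_origin)
  finally show ?thesis .
qed

lemma inj_axis: "inj (\<lambda>i. axis i (1::real) :: real ^ 'N)"
  by (auto simp: inj_on_def axis_eq_axis)

lemma aff_dim_cube_face:
  assumes "(x :: real ^ 'N) \<in> hypercube"
  shows "aff_dim (cube_face T x) = int (card T)"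
proof -
  have "independent ((\<lambda>i. axis i (1::real) :: real ^ 'N) ` T)"
    by (rule independent_mono[OF independent_Basis]) (auto simp: axis_in_Basis_iff)
  then have "dim ((\<lambda>i. axis i (1::real) :: real ^ 'N) ` T) = card T"
    by (simp add: dim_eq_card_independent card_image inj_on_subset[OF inj_axis])
  then show ?thesis
    using aff_dim_linear_image_cube_face[OF linear_id assms, of T] by simp
qed

section \<open>Faces of a linear image and their pullbacks\<close>

lemma face_of_preimage:
  assumes f: "linear f" and S: "convex S" and F: "F face_of f ` S"
  shows "{x \<in> S. f x \<in> F} face_of S"
proof -
  have "{x \<in> S. f x \<in> F} = S \<inter> f -` F" by auto
  then have "convex {x \<in> S. f x \<in> F}"
    using S F f by (simp add: convex_Int convex_linear_vimage face_of_imp_convex)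
  moreover have "f a \<in> F \<and> f b \<in> F"
    if ab: "a \<in> S" "b \<in> S" and x: "f x \<in> F" "x \<in> open_segment a b" for a b x
  \<comment> \<open>A segment may collapse to a point under \<open>f\<close>; an open segment with
    equal endpoints is empty, so the face property says nothing then.\<close>
  proof (cases "f a = f b")
    case True
    then have "f x = f a"
      using x(2) by (auto simp: in_segment linear_add[OF f] linear_scale[OF f]
          scaleR_left_distrib[symmetric])
    then show ?thesis using True x by simp
  next
    case False
    then have "f x \<in> open_segment (f a) (f b)"
      using x(2) by (auto simp: in_segment linear_add[OF f] linear_scale[OF f])
    then show ?thesis using F ab x unfolding face_of_def by blast
  qed
  ultimately show ?thesis unfolding face_of_def by blast
qed

text \<open>The intersection of two faces is a face of each. Were it proper in one of them, its
  dimension would fall below that of \<open>S\<close>, which it contains. This will show that a cube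
  face determines the face of the image it is chosen for.\<close>

lemma face_of_eq_if_common_subset:
  assumes "F1 face_of Q" "F2 face_of Q" "S \<subseteq> F1" "S \<subseteq> F2"
    and "aff_dim F1 = aff_dim S" "aff_dim F2 = aff_dim S"
  shows "F1 = F2"
proof -
  have *: "F = F \<inter> F'" if "F face_of Q" "F' face_of Q" "S \<subseteq> F" "S \<subseteq> F'" "aff_dim F = aff_dim S"
    for F F'
  proof (rule ccontr)
    assume ne: "F \<noteq> F \<inter> F'"
    have "F \<inter> F' face_of F"
      using that by (meson face_of_Int face_of_subset face_of_imp_subset inf_le1)
    then have "aff_dim (F \<inter> F') < aff_dim F"
      using ne that(1) face_of_aff_dim_lt face_of_imp_convex by metis
    moreover have "aff_dim S \<le> aff_dim (F \<inter> F')" using that by (simp add: aff_dim_subset)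
    ultimately show False using that by simp
  qed
  show ?thesis using *[of F1 F2] *[of F2 F1] assms by blast
qed

lemma cube_face_in_preimage:
  fixes f :: "real ^ 'N \<Rightarrow> 'b :: euclidean_space"
  assumes f: "linear f" and F: "F face_of f ` hypercube" and k: "aff_dim F = int k"
  obtains G where "G face_of hypercube" "aff_dim G = int k" "f ` G \<subseteq> F" "aff_dim (f ` G) = int k"
proof -
  define P where "P = {x \<in> hypercube. f x \<in> F}"
  have P: "P face_of hypercube"
    unfolding P_def using face_of_preimage[OF f _ F] polytope_hypercube polytope_imp_convex by blast
  have fP: "f ` P = F" using face_of_imp_subset[OF F] by (auto simp: P_def)
  have "F \<noteq> {}" using k by auto
  then have "P \<noteq> {}" using fP by auto
  then obtain T x where x: "x \<in> hypercube" and T: "\<And>i. i \<notin> T \<Longrightarrow> x $ i = 0 \<or> x $ i = 1"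
    and PT: "P = cube_face T x"
    using face_of_hypercube_cases[OF P] by metis
  define g where "g = (\<lambda>i. f (axis i 1))"
  have fg: "f ` (\<lambda>i. axis i 1) ` U = g ` U" for U by (auto simp: g_def)
  have dimT: "dim (g ` T) = k"
    using aff_dim_linear_image_cube_face[OF f x, of T] k fP PT by (simp add: fg)
  \<comment> \<open>The images of the edge directions of \<open>P\<close> span a space of dimension
    k; \<open>U\<close> selects directions whose images form a basis of it.\<close>
  obtain B where B: "B \<subseteq> g ` T" "independent B" "g ` T \<subseteq> span B" "card B = k"
    using basis_exists[of "g ` T"] dimT by metis
  then obtain U where U: "U \<subseteq> T" "inj_on g U" "B = g ` U"
    by (meson subset_image_inj)
  \<comment> \<open>The coordinates in \<open>T - U\<close> become fixed, so they must be put at a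
    bound of [0,1]; 0 is an arbitrary choice.\<close>
  define x' where "x' = (\<chi> i. if i \<in> T then 0 else x $ i)"
  have x': "x' \<in> hypercube" using x by (auto simp: x'_def hypercube_def)
  have sub: "cube_face U x' \<subseteq> P" using U by (auto simp: PT cube_face_def x'_def)
  show thesis
  proof
    show "cube_face U x' face_of hypercube"
      by (rule cube_face_of_hypercube) (use T in \<open>auto simp: x'_def\<close>)
    show "aff_dim (cube_face U x') = int k"
      using aff_dim_cube_face[OF x'] U B by (simp add: card_image)
    show "f ` cube_face U x' \<subseteq> F" using sub fP by blast
    show "aff_dim (f ` cube_face U x') = int k"
      using aff_dim_linear_image_cube_face[OF f x', of U] U B
      by (simp add: fg dim_eq_card_independent)
  qed
qed

section \<open>The injective choice of cube faces and a face that it misses\<close>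

theorem lemma1p8:
  fixes A :: "real ^ 'N ^ 'n" and k :: nat
  assumes "CARD('n) < CARD('N)"
    and "k \<le> CARD('n)"
  shows "num_faces k ((\<lambda>x. A *v x) ` hypercube) < num_faces k (hypercube :: (real ^ 'N) set)"
proof -
  let ?f = "\<lambda>x. A *v x"
  let ?H = "hypercube :: (real ^ 'N) set"
  have lin: "linear ?f" by simp
  define K where "K = {F. F face_of ?f ` ?H \<and> aff_dim F = int k}"
  define L where "L = {F. F face_of ?H \<and> aff_dim F = int k}"
  have finL: "finite L"
    unfolding L_def using finite_polytope_faces[OF polytope_hypercube] by auto
  have "\<forall>F\<in>K. \<exists>G. G \<in> L \<and> ?f ` G \<subseteq> F \<and> aff_dim (?f ` G) = int k"
  proof
    fix F assume "F \<in> K"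
    then have "F face_of ?f ` ?H" "aff_dim F = int k" by (simp_all add: K_def)
    then obtain G where "G face_of ?H" "aff_dim G = int k" "?f ` G \<subseteq> F" "aff_dim (?f ` G) = int k"
      by (rule cube_face_in_preimage[OF lin])
    then show "\<exists>G. G \<in> L \<and> ?f ` G \<subseteq> F \<and> aff_dim (?f ` G) = int k"
      unfolding L_def mem_Collect_eq by (intro exI[of _ G] conjI)
  qed
  from bchoice[OF this] obtain \<phi>
    where "\<forall>F\<in>K. \<phi> F \<in> L \<and> ?f ` \<phi> F \<subseteq> F \<and> aff_dim (?f ` \<phi> F) = int k" ..
  then have \<phi>: "\<phi> F \<in> L" "?f ` \<phi> F \<subseteq> F" "aff_dim (?f ` \<phi> F) = int k" if "F \<in> K" for F
    using that by blast+
  have uniq: "F1 = F2"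
    if "F1 \<in> K" "F2 \<in> K" "?f ` G \<subseteq> F1" "?f ` G \<subseteq> F2" "aff_dim (?f ` G) = int k" for F1 F2 G
    using that face_of_eq_if_common_subset[of F1 "?f ` ?H" F2 "?f ` G"] by (auto simp: K_def)
  have inj: "inj_on \<phi> K"
    by (intro inj_onI) (metis uniq \<phi>(2,3))
  have "\<not> inj ?f"
    using assms(1) dim_image_eq[OF lin, of UNIV] dim_subset_UNIV[of "range ?f"]
    by (auto simp: inj_on_def)
  then obtain v0 where v0: "A *v v0 = 0" "v0 \<noteq> 0"
    using linear_injective_0[OF lin] by blast
  \<comment> \<open>Scaled to norm 1/2, so that adding \<open>v\<close> to a coordinate 1/2, or
    inwards to a coordinate 0 or 1, stays within [0,1].\<close>
  define v where "v = (1 / (2 * norm v0)) *\<^sub>R v0"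
  have Av: "A *v v = 0" by (simp add: v_def v0 linear_scale[OF lin])
  have v_ne: "v \<noteq> 0" using v0 by (simp add: v_def)
  have v_le: "\<bar>v $ i\<bar> \<le> 1 / 2" for i
    using component_le_norm_cart[of v i] v0 by (simp add: v_def)
  define S where "S = {i. v $ i \<noteq> 0}"
  have "\<exists>T. card T = k \<and> (S \<subseteq> T \<or> T \<subset> S)"
  proof (cases "k < card S")
    case True
    then obtain T where "T \<subseteq> S" "card T = k"
      by (meson less_imp_le_nat obtain_subset_with_card_n)
    then show ?thesis using True by blast
  next
    case False
    then have "\<exists>T. S \<subseteq> T \<and> T \<subseteq> UNIV \<and> card T = k"
      using exists_subset_between[of S k UNIV] assms by simp
    then show ?thesis by blast
  qed
  then obtain T where T: "card T = k" "S \<subseteq> T \<or> T \<subset> S" by blast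
  \<comment> \<open>The vertex of the cube from which \<open>v\<close> points into the cube.\<close>
  define s :: "real ^ 'N" where "s = (\<chi> i. if v $ i < 0 then 1 else 0)"
  have face_L: "cube_face T x \<in> L" if "\<And>i. x $ i = 0 \<or> x $ i = 1" for x
  proof -
    have "x \<in> ?H" unfolding hypercube_def by (clarify, metis that order_refl zero_le_one)
    then show ?thesis
      unfolding L_def using aff_dim_cube_face T that by (auto intro: cube_face_of_hypercube)
  qed
  have s01: "s $ i = 0 \<or> s $ i = 1" for i by (simp add: s_def)
  have sH: "s \<in> ?H" by (simp add: s_def hypercube_def)
  have dimT: "aff_dim (?f ` cube_face T x) = int (dim (?f ` (\<lambda>i. axis i 1) ` T))" if "x \<in> ?H" for x
    by (rule aff_dim_linear_image_cube_face[OF lin that])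
  have "\<exists>G\<in>L. G \<notin> \<phi> ` K"
  proof (cases "cube_face T s \<in> \<phi> ` K")
    case False
    then show ?thesis using face_L[OF s01] by blast
  next
    case True
    then obtain F where F: "F \<in> K" "\<phi> F = cube_face T s" by auto
    have kdim: "dim (?f ` (\<lambda>i. axis i 1) ` T) = k"
      using dimT[OF sH] \<phi>(3)[OF F(1)] F(2) by simp
    let ?E = "(\<lambda>i. axis i (1::real) :: real ^ 'N) ` T"
    have cE: "card ?E = k" using T by (simp add: card_image inj_on_subset[OF inj_axis])
    \<comment> \<open>Since the image of the chosen face keeps dimension k, the map is injective on
      the span of the directions in \<open>T\<close>. This excludes \<open>S \<subseteq> T\<close>,
      which would put the kernel vector \<open>v\<close> into that span.\<close>
    have "card (?f ` ?E) = k"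
      using kdim dim_le_card'[of "?f ` ?E"] card_image_le[of ?E ?f] cE by simp
    then have "independent (?f ` ?E)" and "inj_on ?f ?E"
      using kdim cE card_le_dim_spanning[of "?f ` ?E" "?f ` ?E"]
      by (auto intro!: eq_card_imp_inj_on simp: span_superset)
    then have injE: "inj_on ?f (span ?E)"
      using linear_inj_on_span_independent_image[OF lin] by blast
    have "\<not> S \<subseteq> T"
    proof
      assume ST: "S \<subseteq> T"
      then have "v \<in> span ?E" by (intro in_span_axis) (auto simp: S_def)
      then show False using injE Av v_ne span_zero[of ?E] linear_0[OF lin]
        unfolding inj_on_def by metis
    qed
    then obtain j where j: "j \<in> S" "j \<notin> T" and TS: "T \<subseteq> S" using T by blast
    \<comment> \<open>Flipping coordinate \<open>j\<close>, which lies outside \<open>T\<close>,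
      gives the parallel face that \<phi> will miss.\<close>
    define s' :: "real ^ 'N" where "s' = (\<chi> i. if i = j then 1 - s $ i else s $ i)"
    have s'01: "s' $ i = 0 \<or> s' $ i = 1" for i using s01[of i] by (auto simp: s'_def)
    have s'H: "s' \<in> ?H" using sH by (auto simp: s'_def hypercube_def)
    define P where "P = {x \<in> ?H. A *v x \<in> F}"
    have P: "P face_of ?H"
      unfolding P_def using face_of_preimage[OF lin, of ?H F] F(1)
        polytope_hypercube polytope_imp_convex by (auto simp: K_def)
    have GP: "cube_face T s \<subseteq> P" using \<phi>(2)[OF F(1)] F(2) by (auto simp: P_def cube_face_def)
    have sP: "s \<in> P" using GP sH by (auto simp: cube_face_def)
    \<comment> \<open>The centre of \<open>cube_face T s\<close>. Both \<open>x\<close> and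
      \<open>x + v\<close> lie in the cube and have the same image, so both lie in the pullback
      \<open>P\<close> of \<open>F\<close>.\<close>
    define x where "x = (\<chi> i. if i \<in> T then 1 / 2 else s $ i)"
    have xP: "x \<in> P"
      using GP sH by (auto simp: cube_face_def x_def hypercube_def)
    have "0 \<le> (x + v) $ i \<and> (x + v) $ i \<le> 1" for i
      using abs_le_D1[OF v_le[of i]] abs_le_D2[OF v_le[of i]] by (simp add: x_def s_def)
    then have "x + v \<in> ?H" by (simp add: hypercube_def)
    then have yP: "x + v \<in> P"
      using xP Av by (auto simp: P_def linear_add[OF lin])
    obtain U z where "P = cube_face U z"
      using face_of_hypercube_cases[OF P] xP by blast
    \<comment> \<open>Any point of a cube face can serve as its base point. A coordinate in which
      two points of \<open>P\<close> differ must be free: \<open>x\<close> and \<open>x + v\<close>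
      differ at \<open>j\<close>, and \<open>x\<close> and \<open>s\<close> differ on all of
      \<open>T\<close>.\<close>
    then have U: "P = cube_face U s" using sP by (auto simp: cube_face_def)
    have "j \<in> U"
    proof (rule ccontr)
      assume "j \<notin> U"
      then have "x $ j = s $ j" "(x + v) $ j = s $ j" using xP yP by (auto simp: U cube_face_def)
      then show False using j by (simp add: S_def)
    qed
    moreover have "T \<subseteq> U"
    proof
      fix i assume i: "i \<in> T"
      then have "x $ i \<noteq> s $ i" by (simp add: x_def s_def)
      then show "i \<in> U" using xP by (auto simp: U cube_face_def)
    qed
    ultimately have sub: "cube_face T s' \<subseteq> P"
      by (auto simp: U cube_face_def s'_def)
    have ne: "cube_face T s' \<noteq> cube_face T s"
    proof
      assume "cube_face T s' = cube_face T s"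
      moreover have "s \<in> cube_face T s" using sH by (simp add: cube_face_def)
      ultimately have "s $ j = s' $ j" using j by (auto simp: cube_face_def)
      then show False using s01[of j] by (auto simp: s'_def)
    qed
    have "cube_face T s' \<notin> \<phi> ` K"
    proof
      assume "cube_face T s' \<in> \<phi> ` K"
      then obtain F' where F': "F' \<in> K" "\<phi> F' = cube_face T s'" by auto
      have "?f ` cube_face T s' \<subseteq> F" using sub by (auto simp: P_def)
      \<comment> \<open>The image of the parallel face has dimension k and lies in both
        \<open>F\<close> and \<open>F'\<close>, so they agree; but \<phi> already assigns
        \<open>cube_face T s\<close> to \<open>F\<close>.\<close>
      then have "F' = F"
        using uniq[OF F'(1) F(1), of "cube_face T s'"] \<phi>(2,3)[OF F'(1)] F'(2) by auto
      then show False using F F' ne by simp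
    qed
    then show ?thesis using face_L[OF s'01] by blast
  qed
  then have "\<phi> ` K \<subset> L" using \<phi>(1) by blast
  then have "card (\<phi> ` K) < card L" using finL by (rule psubset_card_mono[rotated])
  then show ?thesis
    unfolding num_faces_def K_def[symmetric] L_def[symmetric] by (simp add: card_image inj)
qed

end
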